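(* (Fundamental theorem of calculus.) Let $I\subseteq\mathbb R$ be a nondegenerate interval, $f\in\mathcal A_D(I)$, $G\in\mathcal D^{lc}(I)$, $a\in I$ and $c\in\mathbb R$. Then $G'=f$ (distributional derivative) and $G(a)=c$ if and only if $G(x)=c+\int_a^x f$ for every $x\in I$.
   Context: Distributions: $\mathcal D$ is the space of test functions on $I$, i.e. infinitely differentiable functions $\varphi:\mathbb R\to\mathbb R$ whose support is a compact subset of $I$; $\varphi_n\to\varphi$ in $\mathcal D$ means that there is a compact $K\subseteq I$ containing all supports of the $\varphi_n$ and that $\varphi_n^{(m)}\to\varphi^{(m)}$ uniformly on $K$ for every $m\ge 0$. $\mathcal D'$ is the space of (sequentially) continuous linear functionals on $\mathcal D$ (distributions on $I$), and the distributional derivative is $\langle T',\varphi\rangle=-\langle T,\varphi'\rangle$. A function $H:I\to\mathbb R$ is left regulated if it has a finite left limit at each point of $I$ except the possible minimum of $I$. "Locally Henstock--Kurzweil ($HK$) integrable" means $HK$ integrable on each compact subinterval of $I$. $H(\inf I+)$ is the limit of $H(t)$ as $t\to\inf I$ from the right (as $t\to-\infty$ if $\inf I=-\infty$), required to be finite. Define: - $\mathcal D^{lr}(I)$: all $H:I\to\mathbb R$ that are left regulated, locally $HK$ integrable, and have a right limit at $\inf I$; - $\mathcal D^{lc}(I)$: all $G\in\mathcal D^{lr}(I)$ that are left continuous at every point of $I$ other than the possible minimum, with $G(\min I)=G(\min I+)$ if $\min I$ exists. A function $H\in\mathcal D^{lr}(I)$ defines a distribution by $\langle H,\varphi\rangle=\int_a^bH(t)\varphi(t)\,dt$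 ($HK$ integral, $\operatorname{supp}\varphi\subseteq[a,b]\subseteq I$). $\mathcal A_D(I)$ is the set of all $f\in\mathcal D'$ with $f=H'$ for some $H\in\mathcal D^{lr}(I)$; such an $H$ is called a primitive of $f$. Every $f\in\mathcal A_D(I)$ has a primitive $F\in\mathcal D^{lc}(I)$, unique up to an additive constant, and the $LD$ primitive integral is $\int_a^b f:=F(b)-F(a)$ for $a,b\in I$. *)

theory Defs
  imports "HOL-Analysis.Analysis"
begin

text \<open>
  Functions on an interval \<open>I\<close> are total functions \<open>real \<Rightarrow> real\<close>, and every condition below
  only constrains their values on \<open>I\<close>. Functionals on the test functions are extensional,
  so that equality of distributions is equality of HOL functions.
\<close>

definition supp :: "(real \<Rightarrow> real) \<Rightarrow> real set" where
  "supp \<phi> = closure {x. \<phi> x \<noteq> 0}"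

definition test_functions :: "real set \<Rightarrow> (real \<Rightarrow> real) set" where
  "test_functions I =
     {\<phi>. (\<forall>m. (deriv ^^ m) \<phi> differentiable_on UNIV) \<and> compact (supp \<phi>) \<and> supp \<phi> \<subseteq> I}"

text \<open>
  The compact set \<open>K\<close> must also contain the support of the limit. Otherwise \<open>K = {}\<close> would make
  the zero sequence converge to every test function.
\<close>

definition test_converges ::
    "real set \<Rightarrow> (nat \<Rightarrow> real \<Rightarrow> real) \<Rightarrow> (real \<Rightarrow> real) \<Rightarrow> bool" where
  "test_converges I \<phi>s \<phi> \<longleftrightarrow>
     (\<exists>K. compact K \<and> K \<subseteq> I \<and> (\<forall>n. supp (\<phi>s n) \<subseteq> K) \<and> supp \<phi> \<subseteq> K \<and>
          (\<forall>m. uniform_limit K (\<lambda>n. (deriv ^^ m) (\<phi>s n)) ((deriv ^^ m) \<phi>) sequentially))"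

definition distributions :: "real set \<Rightarrow> ((real \<Rightarrow> real) \<Rightarrow> real) set" where
  "distributions I =
     {T \<in> extensional (test_functions I).
        (\<forall>\<phi>\<in>test_functions I. \<forall>\<psi>\<in>test_functions I. T (\<lambda>x. \<phi> x + \<psi> x) = T \<phi> + T \<psi>) \<and>
        (\<forall>\<phi>\<in>test_functions I. \<forall>r. T (\<lambda>x. r * \<phi> x) = r * T \<phi>) \<and>
        (\<forall>\<phi>s. \<forall>\<phi>\<in>test_functions I.
           (\<forall>n. \<phi>s n \<in> test_functions I) \<and> test_converges I \<phi>s \<phi>
             \<longrightarrow> (\<lambda>n. T (\<phi>s n)) \<longlonglongrightarrow> T \<phi>)}"

definition distr_deriv ::
    "real set \<Rightarrow> ((real \<Rightarrow> real) \<Rightarrow> real) \<Rightarrow> (real \<Rightarrow> real) \<Rightarrow> real" where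
  "distr_deriv I T = restrict (\<lambda>\<phi>. - T (deriv \<phi>)) (test_functions I)"

definition is_min :: "real set \<Rightarrow> real \<Rightarrow> bool" where
  "is_min I x \<longleftrightarrow> x \<in> I \<and> (\<forall>y\<in>I. x \<le> y)"

definition left_regulated :: "real set \<Rightarrow> (real \<Rightarrow> real) \<Rightarrow> bool" where
  "left_regulated I H \<longleftrightarrow>
     (\<forall>x\<in>I. \<not> is_min I x \<longrightarrow> (\<exists>l. (H \<longlongrightarrow> l) (at_left x)))"

text \<open>\<open>integrable_on\<close> is Henstock--Kurzweil integrability.\<close>

definition locally_HK_integrable :: "real set \<Rightarrow> (real \<Rightarrow> real) \<Rightarrow> bool" where
  "locally_HK_integrable I H \<longleftrightarrow> (\<forall>a b. {a..b} \<subseteq> I \<longrightarrow> H integrable_on {a..b})"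

definition at_inf :: "real set \<Rightarrow> real filter" where
  "at_inf I = (if bdd_below I then at_right (Inf I) else at_bot)"

definition D_lr :: "real set \<Rightarrow> (real \<Rightarrow> real) set" where
  "D_lr I =
     {H. left_regulated I H \<and> locally_HK_integrable I H \<and> (\<exists>l. (H \<longlongrightarrow> l) (at_inf I))}"

definition D_lc :: "real set \<Rightarrow> (real \<Rightarrow> real) set" where
  "D_lc I =
     {G \<in> D_lr I. (\<forall>x\<in>I. \<not> is_min I x \<longrightarrow> (G \<longlongrightarrow> G x) (at_left x)) \<and>
                  (\<forall>x. is_min I x \<longrightarrow> (G \<longlongrightarrow> G x) (at_right x))}"

text \<open>The integral over \<open>{a..b}\<close> is the same for all admissible \<open>a\<close> and \<open>b\<close>.\<close>

definition distr_of :: "real set \<Rightarrow> (real \<Rightarrow> real) \<Rightarrow> (real \<Rightarrow> real) \<Rightarrow> real" where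
  "distr_of I H =
     restrict (\<lambda>\<phi>. THE r. \<forall>a b. a \<le> b \<and> supp \<phi> \<subseteq> {a..b} \<and> {a..b} \<subseteq> I
                            \<longrightarrow> ((\<lambda>t. H t * \<phi> t) has_integral r) {a..b})
              (test_functions I)"

definition is_primitive ::
    "real set \<Rightarrow> ((real \<Rightarrow> real) \<Rightarrow> real) \<Rightarrow> (real \<Rightarrow> real) \<Rightarrow> bool" where
  "is_primitive I f H \<longleftrightarrow> H \<in> D_lr I \<and> distr_deriv I (distr_of I H) = f"

definition A_D :: "real set \<Rightarrow> ((real \<Rightarrow> real) \<Rightarrow> real) set" where
  "A_D I = {f \<in> distributions I. \<exists>H. is_primitive I f H}"

text \<open>
  Every \<open>f \<in> A_D I\<close> has a primitive in \<open>D_lc I\<close>, and it is unique on \<open>I\<close> up to an additive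
  constant, so for \<open>a, b \<in> I\<close> the value does not depend on the choice made here.
\<close>

definition LD_integral :: "real set \<Rightarrow> ((real \<Rightarrow> real) \<Rightarrow> real) \<Rightarrow> real \<Rightarrow> real \<Rightarrow> real" where
  "LD_integral I f a b = (let F = (SOME F. F \<in> D_lc I \<and> is_primitive I f F) in F b - F a)"

end

theory Submission
  imports Defs "HOL-Computational_Algebra.Polynomial"
begin

text \<open>
  Both directions reduce to two facts about a distribution \<open>f\<close> in \<^term>\<open>A_D I\<close>: it has a
  left continuous primitive \<open>F\<close> (\<open>left_continuous_primitive_exists\<close>), so that the integral from \<open>a\<close>
  to \<open>x\<close> is \<open>F x - F a\<close>, and left continuous functions in \<^term>\<open>D_lc I\<close> have the same derivative
  if and only if they differ by a constant on \<open>I\<close>.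

  For existence, take any primitive and replace it by its left limits. The result is
  left continuous, and it differs from the given primitive in countably many points only, since
  points with a jump of a given size are isolated from the left
  (\<open>countable_not_left_continuous\<close>).

  Adding a constant does not change the derivative because the derivative of a test
  function has integral \<open>0\<close> (\<open>distr_deriv_add_const\<close>). Conversely, let \<open>h\<close> be the difference of
  two left continuous primitives of \<open>f\<close>. Then \<open>\<integral>h \<phi>' = 0\<close> for all test functions \<open>\<phi>\<close>. Choosing for \<open>\<phi>'\<close> the
  difference of two narrow unit bumps, just to the left of \<open>x\<close> and of \<open>y\<close>, gives \<open>h x = h y\<close> in the limit
  (\<open>left_continuous_distr_deriv_zero_imp_constant\<close>). The bumps are built from \<open>exp (- 1 / w)\<close>, and
  the integrals exist since a smooth function is locally a difference of monotone
  ones (\<open>integrable_mult_smooth\<close>).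
\<close>

section \<open>Smooth functions and bumps\<close>

definition smooth :: "(real \<Rightarrow> real) \<Rightarrow> bool" where
  "smooth f \<longleftrightarrow> (\<forall>m. (deriv ^^ m) f differentiable_on UNIV)"

lemma smooth_unfold: "smooth f \<longleftrightarrow> f differentiable_on UNIV \<and> smooth (deriv f)"
proof -
  have "(\<forall>m. P m) \<longleftrightarrow> P 0 \<and> (\<forall>m. P (Suc m))" for P :: "nat \<Rightarrow> bool"
    by (metis not0_implies_Suc)
  from this[of "\<lambda>m. (deriv ^^ m) f differentiable_on UNIV"] show ?thesis
    by (simp add: smooth_def funpow_Suc_right del: funpow.simps(2))
qed

text \<open>
  Iterated derivatives are awkward to compute. It is enough to exhibit a family of
  differentiable functions that is closed under differentiation.
\<close>

lemma smooth_coinduct: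
  assumes "f \<in> S" and step: "\<And>g. g \<in> S \<Longrightarrow> g differentiable_on UNIV \<and> deriv g \<in> S"
  shows "smooth f"
proof -
  have "(deriv ^^ m) f \<in> S" for m
    by (induction m) (use assms in auto)
  then show ?thesis
    using step by (auto simp: smooth_def)
qed

lemma smooth_has_deriv:
  assumes "smooth f"
  shows "(f has_real_derivative deriv f x) (at x)"
  using assms unfolding smooth_unfold[of f]
  by (metis DERIV_deriv_iff_real_differentiable UNIV_I differentiable_on_def)

lemma smooth_continuous_on: "smooth f \<Longrightarrow> continuous_on S f"
  by (meson smooth_unfold differentiable_imp_continuous_on continuous_on_subset subset_UNIV)

lemma smooth_lincomb:
  assumes "smooth f" "smooth g"
  shows "smooth (\<lambda>x. r * f x + s * g x)"
proof (rule smooth_coinduct)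
  show "(\<lambda>x. r * f x + s * g x) \<in> {\<lambda>x. r * f x + s * g x | f g. smooth f \<and> smooth g}"
    using assms by blast
next
  fix h assume "h \<in> {\<lambda>x. r * f x + s * g x | f g. smooth f \<and> smooth g}"
  then obtain f g where h: "h = (\<lambda>x. r * f x + s * g x)" and fg: "smooth f" "smooth g"
    by blast
  have d: "(h has_real_derivative (r * deriv f x + s * deriv g x)) (at x)" for x
    unfolding h using fg by (auto intro!: derivative_eq_intros smooth_has_deriv)
  then have "deriv h = (\<lambda>x. r * deriv f x + s * deriv g x)"
    by (auto intro: DERIV_imp_deriv)
  moreover have "h differentiable_on UNIV"
    using d by (metis DERIV_deriv_iff_real_differentiable DERIV_imp_deriv differentiable_at_imp_differentiable_on)
  ultimately show "h differentiable_on UNIV \<and> deriv h \<in> {\<lambda>x. r * f x + s * g x | f g. smooth f \<and> smooth g}"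
    using fg smooth_unfold by blast
qed

text \<open>
  The functions \<open>p / w\<^sup>n * exp (- 1 / w)\<close> on \<open>(u, v)\<close> with \<open>w = (x - u) (v - x)\<close>, extended by \<open>0\<close>.
  The polynomial \<open>p\<close> and the exponent \<open>n\<close> are parameters because with them the family is closed
  under differentiation; the bump itself is the member \<open>p = 1\<close>, \<open>n = 0\<close>.
\<close>

definition bump :: "real \<Rightarrow> real \<Rightarrow> real poly \<Rightarrow> nat \<Rightarrow> real \<Rightarrow> real" where
  "bump u v p n x = (if u < x \<and> x < v
     then poly p x / ((x - u) * (v - x)) ^ n * exp (- 1 / ((x - u) * (v - x))) else 0)"

text \<open>
  The term of degree \<open>n + 2\<close> of the exponential series of \<open>1 / w\<close> is at most its sum. The factor
  \<open>w\<^sup>2\<close> is what makes the derivative vanish where \<open>w\<close> does.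
\<close>

lemma exp_minus_inverse_le:
  assumes "w > 0"
  shows "exp (- 1 / w) / w ^ n \<le> fact (n + 2) * (w::real)\<^sup>2"
proof -
  have "(1 / w) ^ (n + 2) / fact (n + 2) \<le> (\<Sum>k<n+3. (1 / w) ^ k / fact k)"
    by (rule member_le_sum) (use assms in auto)
  also have "\<dots> \<le> exp (1 / w)"
    using assms summable_exp[of "1 / w"] unfolding exp_def
    by (intro sum_le_suminf[THEN order.trans]) (auto simp: divide_inverse mult.commute)
  finally have "(1 / w) ^ (n + 2) / fact (n + 2) \<le> exp (1 / w)" .
  moreover have "0 < fact (n + 2) * w ^ (n + 2)"
    using assms by simp
  moreover have "(1 / w) ^ (n + 2) / fact (n + 2) = 1 / (fact (n + 2) * w ^ (n + 2))"
    by (simp add: power_one_over)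
  ultimately have "1 \<le> exp (1 / w) * (fact (n + 2) * w ^ (n + 2))"
    by (simp only: pos_divide_le_eq)
  then have "1 / (exp (1 / w) * w ^ n) \<le> exp (1 / w) * (fact (n + 2) * w ^ (n + 2)) / (exp (1 / w) * w ^ n)"
    by (rule divide_right_mono) (use assms in simp)
  also have "\<dots> = fact (n + 2) * w\<^sup>2"
    using assms by (simp only: power_add) simp
  finally show ?thesis
    by (simp add: exp_minus divide_inverse)
qed

text \<open>
  Any segment from a point of \<open>(u, v)\<close> to a point \<open>y\<close> outside leaves through \<open>u\<close> or \<open>v\<close>, so
  \<open>w \<le> (v - u) \<bar>x - y\<bar>\<close>. One estimate thus covers the two endpoints and the exterior points at once.
\<close>

lemma bump_quadratic:
  obtains C where "C \<ge> 0" "\<And>x y. \<not> (u < y \<and> y < v) \<Longrightarrow> \<bar>bump u v p n x\<bar> \<le> C * (x - y)\<^sup>2"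
proof -
  have "bounded (poly p ` {u..v})"
    by (intro compact_imp_bounded compact_continuous_image continuous_intros compact_Icc)
  then obtain B where B: "\<And>x. x \<in> {u..v} \<Longrightarrow> \<bar>poly p x\<bar> \<le> B" and "B > 0"
    unfolding bounded_pos by (force simp del: atLeastAtMost_iff)
  let ?C = "B * (fact (n + 2) * (v - u)\<^sup>2)"
  have "\<bar>bump u v p n x\<bar> \<le> ?C * (x - y)\<^sup>2" if y: "\<not> (u < y \<and> y < v)" for x y
  proof (cases "u < x \<and> x < v")
    case True
    define w where "w = (x - u) * (v - x)"
    have w: "w > 0" using True by (simp add: w_def)
    have "w \<le> (v - u) * \<bar>x - y\<bar>"
    proof (cases "y \<le> u")
      case yu: True
      have "(x - u) * (v - x) \<le> \<bar>x - y\<bar> * (v - u)"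
        using True yu by (intro mult_mono) auto
      then show ?thesis by (simp add: w_def mult.commute)
    next
      case False
      then have "(x - u) * (v - x) \<le> (v - u) * \<bar>x - y\<bar>"
        using True y by (intro mult_mono) auto
      then show ?thesis by (simp add: w_def)
    qed
    then have "w\<^sup>2 \<le> ((v - u) * \<bar>x - y\<bar>)\<^sup>2"
      using w by (intro power_mono) auto
    then have w2: "w\<^sup>2 \<le> (v - u)\<^sup>2 * (x - y)\<^sup>2"
      by (simp add: power_mult_distrib)
    have "\<bar>bump u v p n x\<bar> = \<bar>poly p x\<bar> * (exp (- 1 / w) / w ^ n)"
      using True w by (simp add: bump_def abs_mult flip: w_def)
    also have "\<dots> \<le> B * (fact (n + 2) * w\<^sup>2)"
      using True w \<open>B > 0\<close> by (intro mult_mono B exp_minus_inverse_le) auto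
    also have "\<dots> \<le> B * (fact (n + 2) * ((v - u)\<^sup>2 * (x - y)\<^sup>2))"
      using w2 \<open>B > 0\<close> by (intro mult_left_mono) auto
    finally show ?thesis by (simp add: mult_ac)
  qed (use \<open>B > 0\<close> in \<open>auto simp: bump_def\<close>)
  moreover have "?C \<ge> 0" using \<open>B > 0\<close> by simp
  ultimately show thesis using that by blast
qed

text \<open>
  The quotient and chain rules give, inside \<open>(u, v)\<close>, the numerator \<open>q = p' w\<^sup>2 - n p w w' + p w'\<close> over
  \<open>w\<^sup>n\<^sup>+\<^sup>2\<close>; elsewhere the quadratic bound forces the derivative to be \<open>0\<close>.
\<close>

lemma bump_has_deriv:
  obtains q where "\<And>x. (bump u v p n has_real_derivative bump u v q (n + 2) x) (at x)"
proof -
  define w :: "real poly" where "w = [:-u, 1:] * [:v, -1:]"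
  define q where "q = pderiv p * w\<^sup>2 - smult (of_nat n) (p * w * pderiv w) + p * pderiv w"
  have "(bump u v p n has_real_derivative bump u v q (n + 2) x) (at x)" for x
  proof (cases "u < x \<and> x < v")
    case True
    have pw: "poly w t = (t - u) * (v - t)" for t
      by (simp add: w_def algebra_simps)
    have wpos: "poly w x > 0" using True by (simp add: pw)
    let ?i = "\<lambda>t. inverse (poly w t)"
    have di: "(?i has_real_derivative - (poly (pderiv w) x * (?i x)\<^sup>2)) (at x)"
      using DERIV_inverse_fun[OF poly_DERIV, of w x] wpos
      by (simp add: power2_eq_square power_inverse mult.commute)
    \<comment> \<open>the power rule yields the exponent \<open>n - 1\<close>, truncated at \<open>n = 0\<close>, where the factor \<open>n\<close> saves the identity\<close>
    have pow: "real n * y ^ (n - Suc 0) * y\<^sup>2 = real n * y ^ n * y" for y :: real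
      by (cases n) (simp_all add: power2_eq_square)
    have din: "((\<lambda>t. ?i t ^ n) has_real_derivative - (real n * ?i x ^ n * ?i x * poly (pderiv w) x)) (at x)"
    proof -
      have "real n * (- (poly (pderiv w) x * (?i x)\<^sup>2) * ?i x ^ (n - Suc 0))
          = - (poly (pderiv w) x * (real n * ?i x ^ (n - Suc 0) * (?i x)\<^sup>2))"
        by (simp only: mult_ac minus_mult_left minus_mult_right)
      also have "\<dots> = - (real n * ?i x ^ n * ?i x * poly (pderiv w) x)"
        by (subst pow) (simp only: mult_ac)
      finally show ?thesis
        using DERIV_power[OF di, of n] by (simp only:)
    qed
    have de: "((\<lambda>t. exp (- ?i t)) has_real_derivative exp (- ?i x) * (poly (pderiv w) x * (?i x)\<^sup>2)) (at x)"
      using DERIV_chain2[OF DERIV_exp DERIV_minus[OF di]] by simp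
    have "((\<lambda>t. poly p t * ?i t ^ n * exp (- ?i t)) has_real_derivative
        (poly (pderiv p) x * ?i x ^ n - real n * ?i x ^ n * ?i x * poly (pderiv w) x * poly p x) * exp (- ?i x)
         + exp (- ?i x) * (poly (pderiv w) x * (?i x)\<^sup>2) * (poly p x * ?i x ^ n)) (at x)"
      using DERIV_mult[OF DERIV_mult[OF poly_DERIV[of p x] din] de] by simp
    moreover have "(poly (pderiv p) x * ?i x ^ n - real n * ?i x ^ n * ?i x * poly (pderiv w) x * poly p x) * exp (- ?i x)
         + exp (- ?i x) * (poly (pderiv w) x * (?i x)\<^sup>2) * (poly p x * ?i x ^ n)
       = poly q x * ?i x ^ (n + 2) * exp (- ?i x)"
    proof -
      have ident: "(p' * k - N * k * i * w' * p) * E + E * (w' * i\<^sup>2) * (p * k)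
          = (p' * W\<^sup>2 - N * (p * W * w') + p * w') * (k * i\<^sup>2) * E"
        if "W * i = 1" for p' k N i w' p E W :: real
      proof -
        have W: "W\<^sup>2 * i\<^sup>2 = 1" "W * i\<^sup>2 = i"
          using that by (simp flip: power_mult_distrib, simp add: power2_eq_square flip: mult.assoc)
        have "(p' * W\<^sup>2 - N * (p * W * w') + p * w') * (k * i\<^sup>2) * E
            = p' * (W\<^sup>2 * i\<^sup>2) * k * E - N * p * (W * i\<^sup>2) * w' * k * E + p * w' * i\<^sup>2 * k * E"
          by (simp only: ring_distribs left_diff_distrib mult_ac)
        then show ?thesis
          unfolding W by (simp add: ring_distribs left_diff_distrib mult_ac)
      qed
      show ?thesis
        using ident[of "poly w x" "?i x" "poly (pderiv p) x" "?i x ^ n" "real n" "poly (pderiv w) x" "poly p x" "exp (- ?i x)"]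
          wpos by (simp only: q_def poly_add poly_diff poly_mult poly_smult poly_power power_add) simp
    qed
    ultimately have "((\<lambda>t. poly p t / poly w t ^ n * exp (- 1 / poly w t)) has_real_derivative
        poly q x / poly w x ^ (n + 2) * exp (- 1 / poly w x)) (at x)"
      by (simp only: divide_inverse power_inverse) simp
    then have "(bump u v p n has_real_derivative
        poly q x / poly w x ^ (n + 2) * exp (- 1 / poly w x)) (at x)"
      by (rule has_field_derivative_transform_within_open[of _ _ _ "{u<..<v}"])
        (use True in \<open>auto simp: bump_def pw\<close>)
    then show ?thesis
      using True by (simp add: bump_def pw)
  next
    case False
    obtain C where C: "C \<ge> 0" "\<And>t y. \<not> (u < y \<and> y < v) \<Longrightarrow> \<bar>bump u v p n t\<bar> \<le> C * (t - y)\<^sup>2"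
      using bump_quadratic[of u v p n] by blast
    have "((\<lambda>h. (bump u v p n (x + h) - bump u v p n x) / h) \<longlongrightarrow> 0) (at 0)"
    proof (rule Lim_null_comparison)
      show "\<forall>\<^sub>F h in at 0. norm ((bump u v p n (x + h) - bump u v p n x) / h) \<le> C * \<bar>h\<bar>"
      proof (intro always_eventually allI)
        fix h
        have "\<bar>bump u v p n (x + h)\<bar> \<le> (C * \<bar>h\<bar>) * \<bar>h\<bar>"
          using C(2)[OF False, of "x + h"] by (simp add: power2_eq_square)
        then show "norm ((bump u v p n (x + h) - bump u v p n x) / h) \<le> C * \<bar>h\<bar>"
          using C(1) False by (cases "h = 0") (auto simp: bump_def[of u v p n x] divide_le_eq)
      qed
      have "((\<lambda>h. C * \<bar>h\<bar>) \<longlongrightarrow> C * \<bar>0\<bar>) (at 0)"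
        by (intro tendsto_intros)
      then show "((\<lambda>h. C * \<bar>h\<bar>) \<longlongrightarrow> 0) (at 0)" by simp
    qed
    moreover have "bump u v q (n + 2) x = 0" using False by (auto simp: bump_def)
    ultimately show ?thesis by (simp add: DERIV_def)
  qed
  then show thesis using that by blast
qed

lemma smooth_bump: "smooth (bump u v p n)"
proof (rule smooth_coinduct)
  show "bump u v p n \<in> {bump u v p n | p n. True}" by blast
next
  fix g assume "g \<in> {bump u v p n | p n. True}"
  then obtain p n where g: "g = bump u v p n" by blast
  obtain q where q: "\<And>x. (bump u v p n has_real_derivative bump u v q (n + 2) x) (at x)"
    using bump_has_deriv[of u v p n] by blast
  then have "deriv g = bump u v q (n + 2)"
    unfolding g by (intro ext DERIV_imp_deriv)
  moreover have "g differentiable_on UNIV"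
    unfolding g using q by (metis DERIV_deriv_iff_real_differentiable DERIV_imp_deriv differentiable_at_imp_differentiable_on)
  ultimately show "g differentiable_on UNIV \<and> deriv g \<in> {bump u v p n | p n. True}"
    by blast
qed

lemma test_functions_iff:
  "\<phi> \<in> test_functions I \<longleftrightarrow> smooth \<phi> \<and> compact (supp \<phi>) \<and> supp \<phi> \<subseteq> I"
  by (simp add: test_functions_def smooth_def)

lemma supp_subset_Icc:
  assumes "\<And>x. x \<notin> {a..b} \<Longrightarrow> \<phi> x = 0"
  shows "supp \<phi> \<subseteq> {a..b}"
proof -
  have "x \<in> {a..b}" if "\<phi> x \<noteq> 0" for x
    by (rule ccontr) (use that assms[of x] in simp)
  then have "{x. \<phi> x \<noteq> 0} \<subseteq> {a..b}" by blast
  then show ?thesis unfolding supp_def by (rule closure_minimal) simp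
qed

lemma eq_0_outside_supp: "x \<notin> supp \<phi> \<Longrightarrow> \<phi> x = 0"
  using closure_subset[of "{x. \<phi> x \<noteq> 0}"] unfolding supp_def by auto

lemma test_functionI:
  assumes "smooth \<phi>" "\<And>x. x \<notin> {a..b} \<Longrightarrow> \<phi> x = 0" "{a..b} \<subseteq> I"
  shows "\<phi> \<in> test_functions I"
proof -
  have s: "supp \<phi> \<subseteq> {a..b}" using assms(2) by (rule supp_subset_Icc)
  moreover have "closed (supp \<phi>)" by (simp add: supp_def)
  ultimately have "compact (supp \<phi>)"
    unfolding compact_eq_bounded_closed using bounded_subset[OF bounded_closed_interval s] by blast
  with s assms(1,3) show ?thesis unfolding test_functions_iff by blast
qed

lemma smooth_bump_normalized:
  fixes u v :: real
  assumes "u < v"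
  obtains \<psi> where "smooth \<psi>" "\<And>x. \<psi> x \<ge> 0" "\<And>x. x \<notin> {u..v} \<Longrightarrow> \<psi> x = 0"
    "(\<psi> has_integral 1) {u..v}"
proof -
  define f where "f = bump u v 1 0"
  have sm: "smooth f" by (simp add: f_def smooth_bump)
  have nn: "f x \<ge> 0" for x by (simp add: f_def bump_def)
  have int: "f integrable_on {u..v}"
    by (intro integrable_continuous_interval smooth_continuous_on sm)
  have "integral {u..v} f \<noteq> 0"
  proof
    assume "integral {u..v} f = 0"
    then have "\<forall>x\<in>{u..v}. f x = 0"
      using integral_eq_0_iff[of u v f] smooth_continuous_on[OF sm] nn assms by auto
    moreover have "f ((u + v) / 2) > 0" using assms by (simp add: f_def bump_def)
    moreover have "(u + v) / 2 \<in> {u..v}" using assms by simp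
    ultimately show False by (metis less_irrefl)
  qed
  then have pos: "integral {u..v} f > 0"
    using integral_nonneg[OF int] nn by (simp add: order_less_le)
  define c where "c = integral {u..v} f"
  have "smooth (\<lambda>x. (1 / c) * f x + 0 * f x)"
    by (intro smooth_lincomb sm)
  moreover have "((\<lambda>x. (1 / c) * f x + 0 * f x) has_integral 1) {u..v}"
    using has_integral_mult_right[OF integrable_integral[OF int], of "1 / c"] pos
    by (simp add: c_def)
  moreover have "(1 / c) * f x + 0 * f x \<ge> 0" for x
    using nn pos by (simp add: c_def)
  moreover have "(1 / c) * f x + 0 * f x = 0" if "x \<notin> {u..v}" for x
    using that by (auto simp: f_def bump_def)
  ultimately show thesis using that[of "\<lambda>x. (1 / c) * f x + 0 * f x"] by blast
qed

section \<open>Pairing a locally integrable function with a test function\<close>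

lemma is_interval_Icc_subset:
  "\<lbrakk>is_interval (I :: real set); a \<in> I; b \<in> I\<rbrakk> \<Longrightarrow> {a..b} \<subseteq> I"
  by (auto intro: mem_is_interval_1_I[of I a b])

lemma eq_0_outside: "\<lbrakk>supp \<phi> \<subseteq> S; x \<notin> S\<rbrakk> \<Longrightarrow> \<phi> x = 0"
  using eq_0_outside_supp[of x \<phi>] by blast

lemma closed_supp: "closed (supp \<phi>)"
  by (simp add: supp_def)

lemma supp_deriv_subset: "supp (deriv \<phi>) \<subseteq> supp \<phi>"
proof -
  have "deriv \<phi> x = 0" if "x \<notin> supp \<phi>" for x
  proof -
    have "(\<phi> has_real_derivative 0) (at x)"
      by (rule has_field_derivative_transform_within_open[of "\<lambda>_. 0" _ _ "- supp \<phi>"])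
        (use that in \<open>auto simp: eq_0_outside_supp closed_supp\<close>)
    then show ?thesis by (rule DERIV_imp_deriv)
  qed
  then have "{x. deriv \<phi> x \<noteq> 0} \<subseteq> supp \<phi>" by blast
  then show ?thesis
    unfolding supp_def[of "deriv \<phi>"] by (rule closure_minimal) (rule closed_supp)
qed

lemma deriv_test_function:
  assumes "\<phi> \<in> test_functions I"
  shows "deriv \<phi> \<in> test_functions I"
proof -
  have "compact (supp \<phi> \<inter> supp (deriv \<phi>))"
    using assms by (intro compact_Int_closed closed_supp) (simp add: test_functions_iff)
  then have "compact (supp (deriv \<phi>))"
    using supp_deriv_subset[of \<phi>] by (simp add: Int_absorb1)
  then show ?thesis
    using assms supp_deriv_subset[of \<phi>] smooth_unfold[of \<phi>]
    unfolding test_functions_iff by blast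
qed

lemma supp_in_Icc:
  assumes "is_interval I" "I \<noteq> {}" "\<phi> \<in> test_functions I"
  obtains a b where "a \<le> b" "supp \<phi> \<subseteq> {a..b}" "{a..b} \<subseteq> I"
proof (cases "supp \<phi> = {}")
  case True
  moreover obtain x where "x \<in> I" using assms(2) by blast
  ultimately show thesis using that[of x x] by simp
next
  case False
  have c: "compact (supp \<phi>)" and sub: "supp \<phi> \<subseteq> I" using assms(3) by (auto simp: test_functions_iff)
  obtain a where a: "a \<in> supp \<phi>" "\<forall>t\<in>supp \<phi>. a \<le> t" using compact_attains_inf[OF c False] by blast
  obtain b where b: "b \<in> supp \<phi>" "\<forall>t\<in>supp \<phi>. t \<le> b" using compact_attains_sup[OF c False] by blast
  show thesis
  proof
    show "a \<le> b" using a b by blast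
    show "supp \<phi> \<subseteq> {a..b}" using a b by auto
    show "{a..b} \<subseteq> I" using a b sub by (intro is_interval_Icc_subset[OF assms(1)]) auto
  qed
qed

text \<open>
  Henstock--Kurzweil integrable functions need not be absolutely integrable, so boundedness of
  \<open>\<phi>\<close> does not suffice. But \<open>\<phi>\<close> is a difference of the increasing functions \<open>\<phi> + K x\<close> and
  \<open>K x\<close>, where \<open>K\<close> bounds \<open>\<phi>'\<close>, and the second mean value theorem gives integrability of the
  product with a monotone function.
\<close>

lemma integrable_mult_smooth:
  fixes h \<phi> :: "real \<Rightarrow> real"
  assumes h: "h integrable_on {a..b}" and "a \<le> b" and sm: "smooth \<phi>"
  shows "(\<lambda>t. h t * \<phi> t) integrable_on {a..b}"
proof -
  have "smooth (deriv \<phi>)" using sm smooth_unfold by blast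
  then have "bounded (deriv \<phi> ` {a..b})"
    by (intro compact_imp_bounded compact_continuous_image smooth_continuous_on compact_Icc)
  then obtain K where "\<forall>y\<in>deriv \<phi> ` {a..b}. norm y \<le> K"
    unfolding bounded_iff by blast
  then have K: "\<bar>deriv \<phi> t\<bar> \<le> K" if "a \<le> t" "t \<le> b" for t
    using that by simp
  have mono: "\<phi> x + K * x \<le> \<phi> y + K * y" if "a \<le> x" "x \<le> y" "y \<le> b" for x y
  proof (rule DERIV_nonneg_imp_nondecreasing[OF that(2)])
    fix t assume "x \<le> t" "t \<le> y"
    then have "\<bar>deriv \<phi> t\<bar> \<le> K" using that by (intro K) linarith+
    moreover have "((\<lambda>t. \<phi> t + K * t) has_real_derivative deriv \<phi> t + K) (at t)"
      by (auto intro!: derivative_eq_intros smooth_has_deriv sm)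
    ultimately show "\<exists>d. ((\<lambda>t. \<phi> t + K * t) has_real_derivative d) (at t) \<and> 0 \<le> d"
      by (intro exI[of _ "deriv \<phi> t + K"]) auto
  qed
  have mono': "K * x \<le> K * y" if "a \<le> x" "x \<le> y" "y \<le> b" for x y
  proof (rule mult_left_mono[OF that(2)])
    show "0 \<le> K" using K[of x] that by linarith
  qed
  have product: "(\<lambda>t. g t * h t) integrable_on {a..b}"
    if "\<And>x y. \<lbrakk>a \<le> x; x \<le> y; y \<le> b\<rbrakk> \<Longrightarrow> g x \<le> g y" for g
  proof (rule second_mean_value_theorem_full[OF h \<open>a \<le> b\<close>, of g])
    show "g x \<le> g y" if "a \<le> x" "x \<le> y" "y \<le> b" for x y
      using that by (rule \<open>\<And>x y. \<lbrakk>a \<le> x; x \<le> y; y \<le> b\<rbrakk> \<Longrightarrow> g x \<le> g y\<close>)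
  qed (erule has_integral_integrable)
  have "(\<lambda>t. (\<phi> t + K * t) * h t) integrable_on {a..b}"
    by (rule product) (rule mono)
  moreover have "(\<lambda>t. (K * t) * h t) integrable_on {a..b}"
    by (rule product) (rule mono')
  ultimately have "(\<lambda>t. (\<phi> t + K * t) * h t - (K * t) * h t) integrable_on {a..b}"
    by (rule integrable_diff)
  moreover have "(\<phi> t + K * t) * h t - (K * t) * h t = h t * \<phi> t" for t
    by (simp add: distrib_right)
  ultimately show ?thesis by simp
qed

lemma integrable_mult_test_function:
  assumes I: "is_interval I" and H: "locally_HK_integrable I H" and \<phi>: "\<phi> \<in> test_functions I"
  shows "(\<lambda>t. H t * \<phi> t) integrable_on UNIV"
proof (cases "I = {}")
  case True
  then have "\<phi> = (\<lambda>_. 0)" using \<phi> eq_0_outside_supp[of _ \<phi>] by (auto simp: test_functions_iff)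
  then show ?thesis by (simp add: integrable_0)
next
  case False
  obtain a b where ab: "a \<le> b" "supp \<phi> \<subseteq> {a..b}" "{a..b} \<subseteq> I"
    using supp_in_Icc[OF I False \<phi>] by blast
  have "(\<lambda>t. H t * \<phi> t) integrable_on {a..b}"
    using H ab \<phi> by (intro integrable_mult_smooth) (auto simp: locally_HK_integrable_def test_functions_iff)
  then show ?thesis
    by (rule integrable_on_superset) (auto simp: eq_0_outside[OF ab(2)])
qed

text \<open>
  This replaces the definite description in the definition of \<^const>\<open>distr_of\<close>: since \<open>H \<phi>\<close> vanishes
  off the support of \<open>\<phi>\<close>, its integral over every admissible interval is the one over the line.
\<close>

lemma distr_of_eq_integral:
  assumes I: "is_interval I" "I \<noteq> {}" and H: "locally_HK_integrable I H" and \<phi>: "\<phi> \<in> test_functions I"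
  shows "distr_of I H \<phi> = integral UNIV (\<lambda>t. H t * \<phi> t)"
proof -
  have iff: "((\<lambda>t. H t * \<phi> t) has_integral r) {a..b} \<longleftrightarrow> ((\<lambda>t. H t * \<phi> t) has_integral r) UNIV"
    if "supp \<phi> \<subseteq> {a..b}" for a b r
  proof -
    have "(\<lambda>t. if t \<in> {a..b} then H t * \<phi> t else 0) = (\<lambda>t. H t * \<phi> t)"
    proof
      fix t show "(if t \<in> {a..b} then H t * \<phi> t else 0) = H t * \<phi> t"
        using eq_0_outside[OF that, of t] by (cases "t \<in> {a..b}") auto
    qed
    then show ?thesis
      using has_integral_restrict_UNIV[of "{a..b}" "\<lambda>t. H t * \<phi> t" r] by simp
  qed
  obtain a b where ab: "a \<le> b" "supp \<phi> \<subseteq> {a..b}" "{a..b} \<subseteq> I"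
    using supp_in_Icc[OF I \<phi>] by blast
  have int: "((\<lambda>t. H t * \<phi> t) has_integral integral UNIV (\<lambda>t. H t * \<phi> t)) UNIV"
    by (intro integrable_integral integrable_mult_test_function[OF I(1) H \<phi>])
  have "(THE r. \<forall>a b. a \<le> b \<and> supp \<phi> \<subseteq> {a..b} \<and> {a..b} \<subseteq> I
      \<longrightarrow> ((\<lambda>t. H t * \<phi> t) has_integral r) {a..b}) = integral UNIV (\<lambda>t. H t * \<phi> t)"
  proof (rule the_equality)
    show "\<forall>a b. a \<le> b \<and> supp \<phi> \<subseteq> {a..b} \<and> {a..b} \<subseteq> I
      \<longrightarrow> ((\<lambda>t. H t * \<phi> t) has_integral integral UNIV (\<lambda>t. H t * \<phi> t)) {a..b}"
      using int by (simp add: iff)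
    fix r assume "\<forall>a b. a \<le> b \<and> supp \<phi> \<subseteq> {a..b} \<and> {a..b} \<subseteq> I
      \<longrightarrow> ((\<lambda>t. H t * \<phi> t) has_integral r) {a..b}"
    then have "((\<lambda>t. H t * \<phi> t) has_integral r) {a..b}" using ab by blast
    then show "r = integral UNIV (\<lambda>t. H t * \<phi> t)"
      unfolding iff[OF ab(2)] by (rule integral_unique[symmetric])
  qed
  then show ?thesis using \<phi> by (simp add: distr_of_def)
qed

lemma integral_deriv_test_function:
  assumes \<phi>: "\<phi> \<in> test_functions I"
  shows "(deriv \<phi> has_integral 0) UNIV"
proof -
  have "bounded (supp \<phi>)" and sm: "smooth \<phi>"
    using \<phi> compact_imp_bounded by (auto simp: test_functions_iff)
  then obtain r where r: "r > 0" "\<And>x. x \<in> supp \<phi> \<Longrightarrow> \<bar>x\<bar> \<le> r"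
    by (auto simp: bounded_pos)
  have out: "x \<notin> supp \<phi>" if "\<bar>x\<bar> \<ge> r + 1" for x
    using r(2)[of x] that by auto
  have "(deriv \<phi> has_integral \<phi> (r + 1) - \<phi> (- (r + 1))) {- (r + 1)..r + 1}"
    using r sm by (intro fundamental_theorem_of_calculus)
      (auto simp flip: has_real_derivative_iff_has_vector_derivative
        intro: has_field_derivative_at_within smooth_has_deriv)
  moreover have "\<phi> (r + 1) = 0" "\<phi> (- (r + 1)) = 0"
    using r(1) by (simp_all add: eq_0_outside_supp out)
  ultimately have "(deriv \<phi> has_integral 0) {- (r + 1)..r + 1}" by simp
  then show ?thesis
  proof (rule has_integral_on_superset)
    fix x assume "x \<notin> {- (r + 1)..r + 1}"
    then have "x \<notin> supp \<phi>" by (intro out) auto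
    then show "deriv \<phi> x = 0" using supp_deriv_subset eq_0_outside_supp by blast
  qed simp
qed

section \<open>Left continuous functions with zero distributional derivative\<close>

lemma smooth_antideriv:
  assumes "smooth g" "\<And>x. (f has_real_derivative g x) (at x)"
  shows "smooth f"
proof -
  have "deriv f = g" using assms(2) by (auto intro: DERIV_imp_deriv)
  moreover have "f differentiable_on UNIV"
    using assms(2) by (metis DERIV_deriv_iff_real_differentiable DERIV_imp_deriv differentiable_at_imp_differentiable_on)
  ultimately show ?thesis using assms(1) smooth_unfold by metis
qed

text \<open>
  The antiderivative that vanishes to the left of \<open>u\<close> is constant to the right of \<open>v\<close>, and that
  constant is the integral of \<open>g\<close>.
\<close>

lemma test_function_antideriv:
  assumes g: "smooth g" "\<And>x. x \<notin> {u..v} \<Longrightarrow> g x = 0" "(g has_integral 0) {u..v}" and sub: "{u..v} \<subseteq> I"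
  obtains \<phi> where "\<phi> \<in> test_functions I" "deriv \<phi> = g"
proof -
  have int: "g integrable_on {a..b}" for a b
    by (intro integrable_continuous_interval smooth_continuous_on g)
  \<comment> \<open>starting left of \<open>u\<close> keeps \<open>u\<close> itself in the interior of the interval of integration\<close>
  define \<phi> where "\<phi> x = integral {u - 1..x} g" for x
  have zero: "\<phi> x = 0" if x: "x \<notin> {u..v}" for x
  proof (cases "x < u")
    case True
    then have "integral {u - 1..x} g = integral {u - 1..x} (\<lambda>_. 0)"
      by (intro integral_cong g(2)) auto
    then show ?thesis by (simp add: \<phi>_def)
  next
    case False
    have "(g has_integral 0) {u - 1..x}"
      using g(2) by (rule has_integral_on_superset[OF g(3)]) (use False x in auto)
    then show ?thesis by (auto simp: \<phi>_def)
  qed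
  have d: "(\<phi> has_real_derivative g x) (at x)" for x
  proof (cases "x < u")
    case True
    then have "g x = 0" using g(2) by simp
    moreover have "(\<phi> has_real_derivative 0) (at x)"
      by (rule has_field_derivative_transform_within_open[of "\<lambda>_. 0" _ _ "{..<u}"])
        (use True zero in auto)
    ultimately show ?thesis by simp
  next
    case False
    have "((\<lambda>x. integral {u - 1..x} g) has_real_derivative g x) (at x within {u - 1..x + 1})"
      by (rule integral_has_real_derivative[OF smooth_continuous_on[OF g(1)]]) (use False in auto)
    moreover have "at x within {u - 1..x + 1} = at x"
      using False by (intro at_within_interior) (auto simp: interior_atLeastAtMost_real)
    ultimately show ?thesis by (simp add: \<phi>_def[abs_def])
  qed
  show thesis
  proof
    show "\<phi> \<in> test_functions I"
      by (rule test_functionI[OF smooth_antideriv[OF g(1) d] zero sub])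
    show "deriv \<phi> = g" using d by (auto intro: DERIV_imp_deriv)
  qed
qed

lemma integral_against_bump_close:
  fixes \<psi> h :: "real \<Rightarrow> real"
  assumes "smooth \<psi>" "\<And>x. \<psi> x \<ge> 0" "\<And>x. x \<notin> {u..v} \<Longrightarrow> \<psi> x = 0" "(\<psi> has_integral 1) {u..v}"
    and h: "h integrable_on {u..v}" and uv: "u \<le> v" and close: "\<And>t. t \<in> {u..v} \<Longrightarrow> \<bar>h t - c\<bar> \<le> e"
  shows "\<bar>integral UNIV (\<lambda>t. h t * \<psi> t) - c\<bar> \<le> e"
proof -
  have i1: "(\<lambda>t. h t * \<psi> t) integrable_on {u..v}"
    by (rule integrable_mult_smooth[OF h uv assms(1)])
  have "(\<lambda>t. if t \<in> {u..v} then h t * \<psi> t else 0) = (\<lambda>t. h t * \<psi> t)"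
  proof
    fix t show "(if t \<in> {u..v} then h t * \<psi> t else 0) = h t * \<psi> t"
      using assms(3)[of t] by (cases "t \<in> {u..v}") auto
  qed
  then have eq: "integral UNIV (\<lambda>t. h t * \<psi> t) = integral {u..v} (\<lambda>t. h t * \<psi> t)"
    using integral_restrict_UNIV[of "{u..v}" "\<lambda>t. h t * \<psi> t"] by simp
  have ic: "((\<lambda>t. k * \<psi> t) has_integral k) {u..v}" for k
    using has_integral_mult_right[OF assms(4), of k] by simp
  have "((\<lambda>t. h t * \<psi> t - c * \<psi> t) has_integral integral UNIV (\<lambda>t. h t * \<psi> t) - c) {u..v}"
    unfolding eq by (intro has_integral_diff ic integrable_integral i1)
  then have d: "(\<lambda>t. h t * \<psi> t - c * \<psi> t) integrable_on {u..v}"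
     "integral {u..v} (\<lambda>t. h t * \<psi> t - c * \<psi> t) = integral UNIV (\<lambda>t. h t * \<psi> t) - c"
    by auto
  have "norm (integral {u..v} (\<lambda>t. h t * \<psi> t - c * \<psi> t)) \<le> integral {u..v} (\<lambda>t. e * \<psi> t)"
  proof (rule integral_norm_bound_integral[OF d(1)])
    show "(\<lambda>t. e * \<psi> t) integrable_on {u..v}" using ic by blast
    fix t assume "t \<in> {u..v}"
    then have "\<bar>h t - c\<bar> * \<psi> t \<le> e * \<psi> t"
      using close assms(2) by (intro mult_right_mono) auto
    then show "norm (h t * \<psi> t - c * \<psi> t) \<le> e * \<psi> t"
      using assms(2)[of t] by (simp add: abs_mult flip: left_diff_distrib)
  qed
  then show ?thesis unfolding d(2) integral_unique[OF ic[of e]] by simp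
qed

lemma tendsto_at_left_interval:
  fixes h :: "real \<Rightarrow> real"
  assumes "(h \<longlongrightarrow> l) (at_left x)" "e > 0" "u < x"
  obtains v where "u \<le> v" "v < x" "\<And>t. v < t \<Longrightarrow> t < x \<Longrightarrow> \<bar>h t - l\<bar> < e"
proof -
  have "\<forall>\<^sub>F t in at_left x. \<bar>h t - l\<bar> < e"
    using tendstoD[OF assms(1,2)] by (simp add: dist_real_def)
  then obtain b where b: "b < x" "\<And>t. b < t \<Longrightarrow> t < x \<Longrightarrow> \<bar>h t - l\<bar> < e"
    using eventually_at_left[OF \<open>u < x\<close>] by auto
  then show thesis using that[of "max b u"] \<open>u < x\<close> by auto
qed

lemma not_is_minI: "\<lbrakk>z \<in> I; z < x\<rbrakk> \<Longrightarrow> \<not> is_min I x"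
  unfolding is_min_def by (metis not_le)

text \<open>
  The du Bois-Reymond argument, with bumps placed to the left of the points because only left
  continuity is available: for unit bumps \<open>\<psi>\<close> on \<open>[u, x]\<close> and \<open>\<rho>\<close> on \<open>[v, y]\<close>, the difference
  \<open>\<psi> - \<rho>\<close> is the derivative of a test function, so \<open>\<integral>h \<psi> = \<integral>h \<rho>\<close>, while the two
  integrals are close to \<open>h x\<close> and \<open>h y\<close>.
\<close>

lemma left_continuous_distr_deriv_zero_imp_constant:
  assumes I: "is_interval I" and h: "locally_HK_integrable I h"
    and lc: "\<And>x. x \<in> I \<Longrightarrow> \<not> is_min I x \<Longrightarrow> (h \<longlongrightarrow> h x) (at_left x)"
    and zero: "\<And>\<phi>. \<phi> \<in> test_functions I \<Longrightarrow> integral UNIV (\<lambda>t. h t * deriv \<phi> t) = 0"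
    and x: "x \<in> I" "\<not> is_min I x" and y: "y \<in> I" and xy: "x < y"
  shows "h x = h y"
proof -
  have "\<bar>h x - h y\<bar> \<le> e" if e: "e > 0" for e
  proof -
    have ny: "\<not> is_min I y" by (rule not_is_minI[OF x(1) xy])
    have e2: "e / 2 > 0" using e by simp
    obtain z where z: "z \<in> I" "z < x" using x by (auto simp: is_min_def not_le)
    obtain u0 where u0: "z \<le> u0" "u0 < x" "\<And>t. u0 < t \<Longrightarrow> t < x \<Longrightarrow> \<bar>h t - h x\<bar> < e / 2"
      using tendsto_at_left_interval[OF lc[OF x] e2 z(2)] by blast
    obtain v0 where v0: "x \<le> v0" "v0 < y" "\<And>t. v0 < t \<Longrightarrow> t < y \<Longrightarrow> \<bar>h t - h y\<bar> < e / 2"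
      using tendsto_at_left_interval[OF lc[OF y ny] e2 xy] by blast
    \<comment> \<open>midpoints, so that the estimates hold on closed intervals\<close>
    define u v where "u = (u0 + x) / 2" and "v = (v0 + y) / 2"
    have u: "z < u" "u < x" "\<And>t. t \<in> {u..x} \<Longrightarrow> \<bar>h t - h x\<bar> \<le> e / 2"
      using u0 e by (force simp: u_def order_le_less)+
    have v: "x < v" "v < y" "\<And>t. t \<in> {v..y} \<Longrightarrow> \<bar>h t - h y\<bar> \<le> e / 2"
      using v0 e by (force simp: v_def order_le_less)+
    have zy: "{z..y} \<subseteq> I" by (rule is_interval_Icc_subset[OF I z(1) y])
    have hint: "h integrable_on {a..b}" if "z \<le> a" "b \<le> y" for a b
    proof -
      have "{a..b} \<subseteq> I" using that zy by auto
      then show ?thesis using h by (auto simp: locally_HK_integrable_def)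
    qed
    obtain \<psi> where \<psi>: "smooth \<psi>" "\<And>t. \<psi> t \<ge> 0" "\<And>t. t \<notin> {u..x} \<Longrightarrow> \<psi> t = 0" "(\<psi> has_integral 1) {u..x}"
      using smooth_bump_normalized[OF u(2)] by blast
    obtain \<rho> where \<rho>: "smooth \<rho>" "\<And>t. \<rho> t \<ge> 0" "\<And>t. t \<notin> {v..y} \<Longrightarrow> \<rho> t = 0" "(\<rho> has_integral 1) {v..y}"
      using smooth_bump_normalized[OF v(2)] by blast
    have x1: "\<bar>integral UNIV (\<lambda>t. h t * \<psi> t) - h x\<bar> \<le> e / 2"
      by (rule integral_against_bump_close[OF \<psi> hint _ u(3)]) (use u xy in auto)
    have y1: "\<bar>integral UNIV (\<lambda>t. h t * \<rho> t) - h y\<bar> \<le> e / 2"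
      by (rule integral_against_bump_close[OF \<rho> hint _ v(3)]) (use u v xy in auto)
    define g where "g t = 1 * \<psi> t + (-1) * \<rho> t" for t
    have gs: "smooth g" unfolding g_def[abs_def] by (intro smooth_lincomb \<psi> \<rho>)
    have g0: "g t = 0" if "t \<notin> {u..y}" for t
      using that u v xy \<psi>(3)[of t] \<rho>(3)[of t] by (auto simp: g_def)
    have "(\<psi> has_integral 1) {u..y}"
      by (rule has_integral_on_superset[OF \<psi>(4,3)]) (use xy in auto)
    moreover have "(\<rho> has_integral 1) {u..y}"
      by (rule has_integral_on_superset[OF \<rho>(4,3)]) (use u v in auto)
    ultimately have "((\<lambda>t. \<psi> t - \<rho> t) has_integral 1 - 1) {u..y}"
      by (rule has_integral_diff)
    then have gi: "(g has_integral 0) {u..y}" by (simp add: g_def[abs_def])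
    obtain \<phi> where \<phi>: "\<phi> \<in> test_functions I" "deriv \<phi> = g"
      by (rule test_function_antideriv[OF gs g0 gi, of I]) (use u xy zy in auto)
    have t\<psi>: "\<psi> \<in> test_functions I"
      by (rule test_functionI[OF \<psi>(1,3)]) (use u xy zy in auto)
    have t\<rho>: "\<rho> \<in> test_functions I"
      by (rule test_functionI[OF \<rho>(1,3)]) (use u v zy in auto)
    have "integral UNIV (\<lambda>t. h t * g t) = integral UNIV (\<lambda>t. h t * \<psi> t - h t * \<rho> t)"
      by (simp add: g_def algebra_simps)
    also have "\<dots> = integral UNIV (\<lambda>t. h t * \<psi> t) - integral UNIV (\<lambda>t. h t * \<rho> t)"
      by (intro integral_diff integrable_mult_test_function[OF I h] t\<psi> t\<rho>)
    finally show ?thesis using zero[OF \<phi>(1)] x1 y1 unfolding \<phi>(2) by argo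
  qed
  then have "\<bar>h x - h y\<bar> \<le> 0"
    by (rule field_le_epsilon) simp
  then show ?thesis by simp
qed

section \<open>Left continuous representatives\<close>

text \<open>
  Each point owns an open gap of \<open>A\<close> to its left. Distinct points own disjoint gaps, and each
  gap contains a rational number.
\<close>

lemma countable_left_isolated:
  fixes A :: "real set"
  assumes "\<And>x. x \<in> A \<Longrightarrow> \<exists>l<x. \<forall>t\<in>A. \<not> (l < t \<and> t < x)"
  shows "countable A"
proof -
  have "\<exists>r\<in>\<rat>. r < x \<and> (\<forall>t\<in>A. t < x \<longrightarrow> t < r)" if x: "x \<in> A" for x
  proof -
    obtain l where l: "l < x" "\<forall>t\<in>A. \<not> (l < t \<and> t < x)" using assms[OF x] by blast
    obtain r where r: "r \<in> \<rat>" "l < r" "r < x" using Rats_dense_in_real[OF l(1)] by blast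
    have "t < r" if "t \<in> A" "t < x" for t
      using bspec[OF l(2) that(1)] that(2) r(2) by linarith
    then show ?thesis using r by blast
  qed
  then obtain q where q: "\<forall>x\<in>A. q x \<in> \<rat> \<and> q x < x \<and> (\<forall>t\<in>A. t < x \<longrightarrow> t < q x)"
    by metis
  have less: "q x < q y" if "x \<in> A" "y \<in> A" "x < y" for x y
    using q that by (meson less_trans)
  have "inj_on q A"
  proof (rule inj_onI)
    fix x y assume "x \<in> A" "y \<in> A" "q x = q y"
    then show "x = y" using less[of x y] less[of y x] by (cases x y rule: linorder_cases) auto
  qed
  moreover have "countable (q ` A)"
    by (rule countable_subset[OF _ countable_rat]) (use q in blast)
  ultimately show ?thesis by (metis countable_image_inj_on)
qed

text \<open>
  Near \<open>t\<close> on the left, \<open>H\<close> is already close to \<open>l\<close>, so its left limit at \<open>t\<close> is. The condition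
  on \<open>M\<close>, that a property holding eventually also holds just to the left of eventually every point,
  is shared by the two filters of interest: \<^term>\<open>at_left x\<close>, which gives left
  continuity of the function of left limits, and \<^term>\<open>at_inf I\<close>.
\<close>

lemma tendsto_left_limits:
  fixes H F :: "real \<Rightarrow> real"
  assumes H: "(H \<longlongrightarrow> l) M"
    and M: "\<And>P. eventually P M \<Longrightarrow> \<forall>\<^sub>F t in M. eventually P (at_left t)"
    and F: "\<forall>\<^sub>F t in M. (H \<longlongrightarrow> F t) (at_left t)"
  shows "(F \<longlongrightarrow> l) M"
proof (rule tendstoI)
  fix e :: real assume "e > 0"
  then have "\<forall>\<^sub>F t in M. dist (H t) l < e / 2" using tendstoD[OF H, of "e / 2"] by simp
  from M[OF this] F show "\<forall>\<^sub>F t in M. dist (F t) l < e"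
  proof eventually_elim
    case (elim t)
    have "((\<lambda>s. dist (H s) l) \<longlongrightarrow> dist (F t) l) (at_left t)"
      by (intro tendsto_dist elim(2) tendsto_const)
    moreover have "\<forall>\<^sub>F s in at_left t. dist (H s) l \<le> e / 2"
      using elim(1) by (rule eventually_mono) simp
    ultimately have "dist (F t) l \<le> e / 2"
      by (rule tendsto_upperbound) simp
    then show ?case using \<open>e > 0\<close> by simp
  qed
qed

lemma eventually_at_left_iterated:
  assumes "eventually P (at_left (x::real))"
  shows "\<forall>\<^sub>F t in at_left x. eventually P (at_left t)"
proof -
  obtain b where b: "b < x" "\<And>y. b < y \<Longrightarrow> y < x \<Longrightarrow> P y"
    using assms unfolding eventually_at_left_field by blast
  have "eventually P (at_left t)" if "b < t" "t < x" for t
    unfolding eventually_at_left_field using b that by (intro exI[of _ b]) auto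
  then show ?thesis
    unfolding eventually_at_left_field[of _ x] using b(1) by blast
qed

lemma eventually_at_inf:
  "eventually P (at_inf I) \<longleftrightarrow>
     (if bdd_below I then \<exists>b>Inf I. \<forall>y>Inf I. y < b \<longrightarrow> P y else \<exists>N. \<forall>y\<le>N. P y)"
  by (simp add: at_inf_def eventually_at_right_field eventually_at_bot_linorder)

lemma eventually_at_inf_iterated:
  assumes "eventually P (at_inf I)"
  shows "\<forall>\<^sub>F t in at_inf I. eventually P (at_left t)"
proof (cases "bdd_below I")
  case True
  then obtain b where b: "Inf I < b" "\<forall>y>Inf I. y < b \<longrightarrow> P y"
    using assms unfolding eventually_at_inf by auto
  have "eventually P (at_left t)" if "Inf I < t" "t < b" for t
    unfolding eventually_at_left_field using b that by (intro exI[of _ "Inf I"]) auto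
  then show ?thesis
    using b(1) unfolding eventually_at_inf if_P[OF True] by blast
next
  case False
  then obtain N where N: "\<forall>y\<le>N. P y"
    using assms unfolding eventually_at_inf by auto
  have "eventually P (at_left t)" if "t \<le> N" for t
    unfolding eventually_at_left_field using N that by (intro exI[of _ "t - 1"]) auto
  then show ?thesis
    unfolding eventually_at_inf if_not_P[OF False] by blast
qed

lemma eventually_at_left_not_min:
  assumes I: "is_interval I" and x: "x \<in> I" "\<not> is_min I x"
  shows "\<forall>\<^sub>F t in at_left x. t \<in> I \<and> \<not> is_min I t"
proof -
  obtain z where z: "z \<in> I" "z < x" using x by (auto simp: is_min_def not_le)
  have "t \<in> I \<and> \<not> is_min I t" if "z < t" "t < x" for t
    using mem_is_interval_1_I[OF I z(1) x(1), of t] not_is_minI[OF z(1) that(1)] that by simp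
  then show ?thesis unfolding eventually_at_left_field using z(2) by blast
qed

lemma eventually_at_inf_not_min:
  assumes I: "is_interval I" and nondeg: "\<exists>x\<in>I. \<exists>y\<in>I. x \<noteq> y"
  shows "\<forall>\<^sub>F t in at_inf I. t \<in> I \<and> \<not> is_min I t"
proof -
  obtain x y where xy: "x \<in> I" "y \<in> I" "x < y" using nondeg by (metis linorder_less_linear)
  have in_I: "t \<in> I \<and> \<not> is_min I t" if "s \<in> I" "s < t" "t < y" for s t
    using mem_is_interval_1_I[OF I that(1) xy(2), of t] not_is_minI[OF that(1,2)] that by simp
  show ?thesis
  proof (cases "bdd_below I")
    case True
    have "Inf I \<le> x" by (rule cInf_lower[OF xy(1) True])
    then have "Inf I < y" using xy(3) by simp
    moreover have "t \<in> I \<and> \<not> is_min I t" if "Inf I < t" "t < y" for t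
    proof -
      have "I \<noteq> {}" using xy by blast
      then obtain s where "s \<in> I" "s < t" using \<open>Inf I < t\<close> cInf_less_iff[OF _ True, of t] by auto
      then show ?thesis using that(2) by (rule in_I)
    qed
    ultimately show ?thesis
      unfolding eventually_at_inf if_P[OF True] by blast
  next
    case False
    have "t \<in> I \<and> \<not> is_min I t" if "t \<le> y - 1" for t
    proof -
      obtain s where "s \<in> I" "s < t" using False unfolding bdd_below_def by (meson not_le)
      then show ?thesis by (rule in_I) (use that in simp)
    qed
    then show ?thesis
      unfolding eventually_at_inf if_not_P[OF False] by blast
  qed
qed

lemma negligible_countable:
  assumes "countable (A :: real set)"
  shows "negligible A"
proof -
  have "negligible (\<Union>x\<in>A. {x})"
    by (rule negligible_countable_Union) (use assms in auto)
  then show ?thesis by simp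
qed

text \<open>
  Just to the left of \<open>x\<close> all values of \<open>H\<close>, hence also its left limits there, are close to
  the left limit \<open>F x\<close>. So for each \<open>d > 0\<close> the points with \<open>\<bar>H - F\<bar> > d\<close> are isolated from the left.
\<close>

lemma countable_not_left_continuous:
  fixes H F :: "real \<Rightarrow> real"
  assumes F: "\<And>x. x \<in> S \<Longrightarrow> (H \<longlongrightarrow> F x) (at_left x)"
  shows "countable {x \<in> S. F x \<noteq> H x}"
proof -
  define A where "A n = {x \<in> S. 1 / real (Suc n) < \<bar>H x - F x\<bar>}" for n
  have "countable (A n)" for n
  proof (rule countable_left_isolated)
    fix x assume x: "x \<in> A n"
    define d where "d = 1 / real (Suc n)"
    have d: "d > 0" by (simp add: d_def)
    have "\<forall>\<^sub>F t in at_left x. dist (H t) (F x) < d / 2"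
      using tendstoD[OF F, of x "d / 2"] x d by (simp add: A_def)
    then obtain l where l: "l < x" "\<And>t. l < t \<Longrightarrow> t < x \<Longrightarrow> dist (H t) (F x) < d / 2"
      unfolding eventually_at_left_field by blast
    have "t \<notin> A n" if t: "l < t" "t < x" for t
    proof
      assume tA: "t \<in> A n"
      have "((\<lambda>s. dist (H s) (F x)) \<longlongrightarrow> dist (F t) (F x)) (at_left t)"
        using tA by (intro tendsto_dist F tendsto_const) (simp add: A_def)
      moreover have "\<forall>\<^sub>F s in at_left t. dist (H s) (F x) \<le> d / 2"
        unfolding eventually_at_left_field
      proof (intro exI[of _ l] conjI allI impI)
        fix s assume "l < s" "s < t"
        then show "dist (H s) (F x) \<le> d / 2" using l(2)[of s] t by simp
      qed (use t in simp)
      ultimately have "dist (F t) (F x) \<le> d / 2"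
        by (rule tendsto_upperbound) simp
      moreover have "dist (H t) (F x) < d / 2" using l(2) t by blast
      ultimately have "\<bar>H t - F t\<bar> < d" unfolding dist_real_def by linarith
      then show False using tA by (simp add: A_def d_def)
    qed
    then show "\<exists>l<x. \<forall>t\<in>A n. \<not> (l < t \<and> t < x)" using l(1) by blast
  qed
  then have "countable (\<Union>n. A n)" by simp
  moreover have "{x \<in> S. F x \<noteq> H x} \<subseteq> (\<Union>n. A n)"
  proof
    fix x assume x: "x \<in> {x \<in> S. F x \<noteq> H x}"
    then obtain n where "1 / real (Suc n) < \<bar>H x - F x\<bar>"
      using reals_Archimedean[of "\<bar>H x - F x\<bar>"] by (auto simp: inverse_eq_divide)
    then show "x \<in> (\<Union>n. A n)" using x by (auto simp: A_def)
  qed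
  ultimately show ?thesis by (rule countable_subset[rotated])
qed

lemma is_min_at_inf:
  assumes "is_min I x"
  shows "at_inf I = at_right x"
proof -
  have "Inf I = x" using assms by (intro cInf_eq_minimum) (auto simp: is_min_def)
  moreover have "bdd_below I" using assms by (auto simp: is_min_def bdd_below_def)
  ultimately show ?thesis by (simp add: at_inf_def)
qed

text \<open>
  Replace \<open>H\<close> by its left limits, and at a minimum of \<open>I\<close> by its right limit. This changes \<open>H\<close>
  on a countable set only, which affects neither integrability nor integrals.
\<close>

lemma left_continuous_representative:
  assumes I: "is_interval I" and nondeg: "\<exists>x\<in>I. \<exists>y\<in>I. x \<noteq> y" and H: "H \<in> D_lr I"
  obtains F where "F \<in> D_lc I" "countable {x \<in> I. F x \<noteq> H x}"
proof -
  obtain m where m: "(H \<longlongrightarrow> m) (at_inf I)" using H by (auto simp: D_lr_def)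
  define F where "F x = (if is_min I x then m else Lim (at_left x) H)" for x
  have F: "(H \<longlongrightarrow> F x) (at_left x)" if "x \<in> I" "\<not> is_min I x" for x
  proof -
    obtain l where l: "(H \<longlongrightarrow> l) (at_left x)"
      using H \<open>x \<in> I\<close> \<open>\<not> is_min I x\<close> by (auto simp: D_lr_def left_regulated_def)
    then have "Lim (at_left x) H = l" by (intro tendsto_Lim) simp_all
    then show ?thesis using l \<open>\<not> is_min I x\<close> by (simp add: F_def)
  qed
  have left: "(F \<longlongrightarrow> F x) (at_left x)" if "x \<in> I" "\<not> is_min I x" for x
  proof (rule tendsto_left_limits[OF F[OF that] eventually_at_left_iterated])
    show "\<forall>\<^sub>F t in at_left x. (H \<longlongrightarrow> F t) (at_left t)"
      using eventually_at_left_not_min[OF I that] by (rule eventually_mono) (rule F; simp)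
  qed
  have inf: "(F \<longlongrightarrow> m) (at_inf I)"
  proof (rule tendsto_left_limits[OF m eventually_at_inf_iterated])
    show "\<forall>\<^sub>F t in at_inf I. (H \<longlongrightarrow> F t) (at_left t)"
      using eventually_at_inf_not_min[OF I nondeg] by (rule eventually_mono) (rule F; simp)
  qed
  have "{x. is_min I x} \<subseteq> {Inf I}"
    by (auto simp: is_min_def intro!: cInf_eq_minimum[symmetric])
  then have "countable {x. is_min I x}" using countable_subset by blast
  moreover have "countable {x \<in> {x \<in> I. \<not> is_min I x}. F x \<noteq> H x}"
    by (rule countable_not_left_continuous) (use F in blast)
  ultimately have "countable ({x \<in> {x \<in> I. \<not> is_min I x}. F x \<noteq> H x} \<union> {x. is_min I x})"
    by simp
  then have count: "countable {x \<in> I. F x \<noteq> H x}"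
    by (rule countable_subset[rotated]) auto
  have "F integrable_on {a..b}" if ab: "{a..b} \<subseteq> I" for a b
  proof (rule integrable_spike[OF _ negligible_countable[OF count]])
    show "H integrable_on {a..b}"
      using H ab by (auto simp: D_lr_def locally_HK_integrable_def)
    show "F x = H x" if "x \<in> {a..b} - {x \<in> I. F x \<noteq> H x}" for x
      using that ab by auto
  qed
  then have "F \<in> D_lr I"
    using left inf unfolding D_lr_def left_regulated_def locally_HK_integrable_def by blast
  moreover have "(F \<longlongrightarrow> F x) (at_right x)" if "is_min I x" for x
    using inf is_min_at_inf[OF that] that by (simp add: F_def)
  ultimately have "F \<in> D_lc I"
    using left by (simp add: D_lc_def)
  then show thesis using count by (rule that)
qed

section \<open>Primitives and the fundamental theorem\<close>

lemma distr_of_cong_countable: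
  assumes I: "is_interval I" "I \<noteq> {}" and loc: "locally_HK_integrable I F" "locally_HK_integrable I H"
    and count: "countable {x \<in> I. F x \<noteq> H x}"
  shows "distr_of I F = distr_of I H"
proof
  fix \<phi>
  show "distr_of I F \<phi> = distr_of I H \<phi>"
  proof (cases "\<phi> \<in> test_functions I")
    case True
    have "integral UNIV (\<lambda>t. F t * \<phi> t) = integral UNIV (\<lambda>t. H t * \<phi> t)"
    proof (rule integral_spike[OF negligible_countable[OF count]])
      fix t assume t: "t \<in> UNIV - {x \<in> I. F x \<noteq> H x}"
      have "\<phi> t = 0" if "t \<notin> I"
        using True that by (intro eq_0_outside[of _ I]) (simp_all add: test_functions_iff)
      then show "H t * \<phi> t = F t * \<phi> t" using t by auto
    qed
    then show ?thesis using True by (simp add: distr_of_eq_integral I loc)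
  next
    case False
    then show ?thesis by (simp add: distr_of_def)
  qed
qed

lemma distr_deriv_add_const:
  assumes I: "is_interval I" "I \<noteq> {}" and loc: "locally_HK_integrable I F" "locally_HK_integrable I G"
    and eq: "\<And>x. x \<in> I \<Longrightarrow> G x = k + F x"
  shows "distr_deriv I (distr_of I G) = distr_deriv I (distr_of I F)"
proof
  fix \<phi>
  show "distr_deriv I (distr_of I G) \<phi> = distr_deriv I (distr_of I F) \<phi>"
  proof (cases "\<phi> \<in> test_functions I")
    case True
    note d = deriv_test_function[OF True]
    have "G t * deriv \<phi> t = k * deriv \<phi> t + F t * deriv \<phi> t" for t
    proof (cases "t \<in> I")
      case False
      then have "deriv \<phi> t = 0"
        using d by (intro eq_0_outside[of _ I]) (simp_all add: test_functions_iff)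
      then show ?thesis by simp
    qed (simp add: eq distrib_right)
    moreover have "((\<lambda>t. k * deriv \<phi> t + F t * deriv \<phi> t) has_integral
        k * 0 + integral UNIV (\<lambda>t. F t * deriv \<phi> t)) UNIV"
      by (intro has_integral_add has_integral_mult_right integral_deriv_test_function[OF True]
          integrable_integral integrable_mult_test_function[OF I(1) loc(1) d])
    ultimately have "integral UNIV (\<lambda>t. G t * deriv \<phi> t) = integral UNIV (\<lambda>t. F t * deriv \<phi> t)"
      using integral_unique by simp
    then show ?thesis
      using True d by (simp add: distr_deriv_def distr_of_eq_integral I loc)
  qed (simp add: distr_deriv_def)
qed

lemma D_lc_locally_HK: "F \<in> D_lc I \<Longrightarrow> locally_HK_integrable I F"
  by (simp add: D_lc_def D_lr_def)

text \<open>
  The constancy result for left continuous functions covers all points except the minimum of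
  \<open>I\<close>; there the value is the right limit, hence the same constant.
\<close>

lemma left_continuous_primitives_differ_by_const:
  assumes I: "is_interval I" and F: "F \<in> D_lc I" and G: "G \<in> D_lc I"
    and eq: "distr_deriv I (distr_of I G) = distr_deriv I (distr_of I F)"
    and x: "x \<in> I" and y: "y \<in> I"
  shows "G x - F x = G y - F y"
proof -
  define h where "h x = G x - F x" for x
  have ne: "I \<noteq> {}" using x by blast
  have h: "locally_HK_integrable I h"
    using D_lc_locally_HK[OF F] D_lc_locally_HK[OF G]
    by (auto simp: h_def[abs_def] locally_HK_integrable_def intro!: integrable_diff)
  have zero: "integral UNIV (\<lambda>t. h t * deriv \<phi> t) = 0" if \<phi>: "\<phi> \<in> test_functions I" for \<phi>
  proof -
    note d = deriv_test_function[OF \<phi>]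
    have "integral UNIV (\<lambda>t. G t * deriv \<phi> t) = integral UNIV (\<lambda>t. F t * deriv \<phi> t)"
      using fun_cong[OF eq, of \<phi>] \<phi> d
      by (simp add: distr_deriv_def distr_of_eq_integral I ne D_lc_locally_HK F G)
    moreover have "integral UNIV (\<lambda>t. G t * deriv \<phi> t - F t * deriv \<phi> t)
        = integral UNIV (\<lambda>t. G t * deriv \<phi> t) - integral UNIV (\<lambda>t. F t * deriv \<phi> t)"
      by (intro integral_diff integrable_mult_test_function[OF I _ d] D_lc_locally_HK F G)
    ultimately show ?thesis by (simp add: h_def left_diff_distrib)
  qed
  have left: "(h \<longlongrightarrow> h t) (at_left t)" if "t \<in> I" "\<not> is_min I t" for t
    using F G that unfolding h_def[abs_def] D_lc_def by (intro tendsto_diff) auto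
  have less: "h s = h t" if s: "s \<in> I" and t: "t \<in> I" and st: "s < t" for s t
  proof (cases "is_min I s")
    case False
    then show ?thesis
      using left_continuous_distr_deriv_zero_imp_constant[OF I h left zero s _ t st] by blast
  next
    case True
    have "h r = h t" if "s < r" "r < t" for r
    proof -
      have "r \<in> I" using mem_is_interval_1_I[OF I s t] that by simp
      moreover have "\<not> is_min I r" by (rule not_is_minI[OF s that(1)])
      ultimately show ?thesis
        using left_continuous_distr_deriv_zero_imp_constant[OF I h left zero _ _ t that(2)] by blast
    qed
    then have "\<forall>\<^sub>F r in at_right s. h t = h r"
      unfolding eventually_at_right_field using st by (intro exI[of _ t]) auto
    then have "(h \<longlongrightarrow> h t) (at_right s)" using tendsto_eventually[of h] by (simp add: eq_commute)
    moreover have "(h \<longlongrightarrow> h s) (at_right s)"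
      using F G True unfolding h_def[abs_def] D_lc_def by (intro tendsto_diff) auto
    ultimately show ?thesis using tendsto_unique trivial_limit_at_right_real by metis
  qed
  have "h x = h y"
    using less[OF x y] less[OF y x] by (metis linorder_less_linear)
  then show ?thesis by (simp add: h_def)
qed

lemma left_continuous_primitive_exists:
  assumes I: "is_interval I" and nondeg: "\<exists>x\<in>I. \<exists>y\<in>I. x \<noteq> y" and f: "f \<in> A_D I"
  obtains F where "F \<in> D_lc I" "is_primitive I f F"
proof -
  obtain H where H: "H \<in> D_lr I" "distr_deriv I (distr_of I H) = f"
    using f by (auto simp: A_D_def is_primitive_def)
  obtain F where F: "F \<in> D_lc I" "countable {x \<in> I. F x \<noteq> H x}"
    using left_continuous_representative[OF I nondeg H(1)] by blast
  have "I \<noteq> {}" using nondeg by blast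
  then have "distr_of I F = distr_of I H"
    by (rule distr_of_cong_countable[OF I _ D_lc_locally_HK[OF F(1)] _ F(2)])
      (use H in \<open>simp add: D_lr_def\<close>)
  then have "is_primitive I f F"
    using F H by (simp add: is_primitive_def D_lc_def)
  then show thesis using F(1) that by blast
qed

theorem theorem3p3:
  fixes I :: "real set" and f :: "(real \<Rightarrow> real) \<Rightarrow> real" and G :: "real \<Rightarrow> real" and a c :: real
  assumes "is_interval I" and "\<exists>x\<in>I. \<exists>y\<in>I. x \<noteq> y"
    and "f \<in> A_D I" and "G \<in> D_lc I" and "a \<in> I"
  shows "(distr_deriv I (distr_of I G) = f \<and> G a = c) \<longleftrightarrow>
         (\<forall>x\<in>I. G x = c + LD_integral I f a x)"
proof -
  define F where "F = (SOME F. F \<in> D_lc I \<and> is_primitive I f F)"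
  have "\<exists>F. F \<in> D_lc I \<and> is_primitive I f F"
    using left_continuous_primitive_exists[OF assms(1,2,3)] by blast
  then have "F \<in> D_lc I \<and> is_primitive I f F"
    unfolding F_def by (rule someI_ex)
  then have F: "F \<in> D_lc I" "distr_deriv I (distr_of I F) = f"
    by (simp_all add: is_primitive_def)
  have LD: "LD_integral I f a x = F x - F a" for x
    by (simp add: LD_integral_def F_def Let_def)
  show ?thesis
  proof
    assume G: "distr_deriv I (distr_of I G) = f \<and> G a = c"
    show "\<forall>x\<in>I. G x = c + LD_integral I f a x"
    proof
      fix x assume "x \<in> I"
      then have "G x - F x = G a - F a"
        by (intro left_continuous_primitives_differ_by_const[OF assms(1) F(1) assms(4) _ _ assms(5)])
          (use G F(2) in auto)
      then show "G x = c + LD_integral I f a x" using G LD by simp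
    qed
  next
    assume eq: "\<forall>x\<in>I. G x = c + LD_integral I f a x"
    have "distr_deriv I (distr_of I G) = distr_deriv I (distr_of I F)"
    proof (rule distr_deriv_add_const)
      show "I \<noteq> {}" using assms(5) by blast
      show "G x = (c - F a) + F x" if "x \<in> I" for x using eq that LD by simp
    qed (use assms D_lc_locally_HK F in auto)
    then show "distr_deriv I (distr_of I G) = f \<and> G a = c"
      using F(2) eq assms(5) LD by simp
  qed
qed

end
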